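(* Let $\mathcal H$ be a real Hilbert space, $A,B:\mathcal H\to2^{\mathcal H}$ maximal monotone, $C:\mathcal H\to\mathcal H$ $\beta$-cocoercive with $\beta>0$. Let $\varepsilon\in(0,1)$, $\gamma\in(0,2\beta\varepsilon)$, $\alpha=1/(2-\varepsilon)$, $\lambda\in(0,1/\alpha)$. Let $T:=I_{\mathcal H}-J_{\gamma B}+J_{\gamma A}\circ(2J_{\gamma B}-I_{\mathcal H}-\gamma C\circ J_{\gamma B})$, let $z\in\mathcal H$, $z^+=(1-\lambda)z+\lambda Tz$, and let $z^\ast$ be a fixed point of $T$. Then $$\|z^+-z^\ast\|\le(1-c(\lambda))^{1/2}\|z-z^\ast\|$$ under each of the conditions below, where $c(\lambda)\in[0,1]$ is given by: 1. If $B$ is $L_B$-Lipschitz and $\mu_B$-strongly monotone: $c(\lambda)=\dfrac{2\mu_B\gamma\lambda}{(1+\gamma L_B)^2}$. 2. If $A$ is $L_A$-Lipschitz and $\mu_A$-strongly monotone: $c(\lambda)=\dfrac\lambda3\min\left\{\dfrac{2\mu_A\gamma}{(1+\gamma L_A)^2},\ \dfrac\lambda4\left(\dfrac1{\alpha\lambda}-1\right),\ \dfrac{2\beta-\gamma/\varepsilon}{\gamma}\right\}$. 3. If $A$ is $\mu_A$-strongly monotone and $B$ is $L_B$-Lipschitz: $c(\lambda)=\dfrac{\lambda}{3(1+2\gamma^2L_B^2)}\min\left\{2\gamma\mu_A,\ \lambda\left(\dfrac1{\alpha\lambda}-1\right)\right\}$. 4. If $A$ is $L_A$-Lipschitz and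 $B$ is $\mu_B$-strongly monotone: $c(\lambda)=\dfrac\lambda4\min\left\{\dfrac{2\gamma\mu_B}{1+2\gamma^2L_A^2},\ \dfrac{2\beta-\gamma/\varepsilon}{\gamma},\ \dfrac{\lambda}{1+2\gamma^2L_A^2}\left(\dfrac1{\alpha\lambda}-1\right)\right\}$. 5. If $A$ is $L_A$-Lipschitz, $C$ is $\mu_C$-strongly monotone, and $\eta\in(0,1)$ is large enough that $2\eta\beta>\gamma/\varepsilon$: $c(\lambda)=\dfrac\lambda4\min\left\{\dfrac{2\gamma\mu_C(1-\eta)}{1+2\gamma^2L_A^2},\ \dfrac{2\eta\beta-\gamma/\varepsilon}{\gamma},\ \dfrac{\lambda}{1+2\gamma^2L_A^2}\left(\dfrac1{\alpha\lambda}-1\right)\right\}$. 6. If $B$ is $L_B$-Lipschitz, $C$ is $\mu_C$-strongly monotone, and $\eta\in(0,1)$ is large enough that $2\eta\beta>\gamma/\varepsilon$: $c(\lambda)=\dfrac{2\gamma\lambda\mu_C(1-\eta)}{(1+\gamma L_B)^2}$.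
   Context: $C$ is $\beta$-cocoercive if $\langle Cx-Cy,x-y\rangle\ge\beta\|Cx-Cy\|^2$ for all $x,y$. $J_S:=(I_{\mathcal H}+S)^{-1}$. An operator $S$ is $\mu$-strongly monotone ($\mu>0$) if $\langle x-y,u-v\rangle\ge\mu\|x-y\|^2$ for all $u\in Sx$, $v\in Sy$. Saying that $A$ (or $B$) is $L$-Lipschitz includes that it is single-valued on $\mathcal H$. The space $\mathcal H$ is nonzero. *)

theory Defs
  imports "HOL-Analysis.Analysis"
begin

definition monotone_operator :: "('a::real_inner \<Rightarrow> 'a set) \<Rightarrow> bool" where
  "monotone_operator S \<longleftrightarrow>
     (\<forall>x y. \<forall>u\<in>S x. \<forall>v\<in>S y. inner (x - y) (u - v) \<ge> 0)"

definition maximal_monotone :: "('a::real_inner \<Rightarrow> 'a set) \<Rightarrow> bool" where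
  "maximal_monotone S \<longleftrightarrow> monotone_operator S \<and>
     (\<forall>R. monotone_operator R \<and> (\<forall>x. S x \<subseteq> R x) \<longrightarrow> R = S)"

definition strongly_monotone :: "real \<Rightarrow> ('a::real_inner \<Rightarrow> 'a set) \<Rightarrow> bool" where
  "strongly_monotone \<mu> S \<longleftrightarrow> \<mu> > 0 \<and>
     (\<forall>x y. \<forall>u\<in>S x. \<forall>v\<in>S y. inner (x - y) (u - v) \<ge> \<mu> * (norm (x - y))\<^sup>2)"

text \<open>Single-valued on the whole space, and Lipschitz there. Note that \<open>lipschitz_on\<close> includes
  \<open>0 \<le> L\<close>.\<close>

definition lipschitz_operator :: "real \<Rightarrow> ('a::real_inner \<Rightarrow> 'a set) \<Rightarrow> bool" where
  "lipschitz_operator L S \<longleftrightarrow> (\<exists>f. (\<forall>x. S x = {f x}) \<and> L-lipschitz_on UNIV f)"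

definition cocoercive :: "real \<Rightarrow> ('a::real_inner \<Rightarrow> 'a) \<Rightarrow> bool" where
  "cocoercive \<beta> C \<longleftrightarrow>
     (\<forall>x y. inner (C x - C y) (x - y) \<ge> \<beta> * (norm (C x - C y))\<^sup>2)"

definition scale_operator :: "real \<Rightarrow> ('a::real_inner \<Rightarrow> 'a set) \<Rightarrow> 'a \<Rightarrow> 'a set" where
  "scale_operator \<gamma> S x = {\<gamma> *\<^sub>R u | u. u \<in> S x}"

definition id_plus :: "('a::real_inner \<Rightarrow> 'a set) \<Rightarrow> 'a \<Rightarrow> 'a set" where
  "id_plus S x = {x + u | u. u \<in> S x}"

definition inverse_operator :: "('a \<Rightarrow> 'a set) \<Rightarrow> 'a \<Rightarrow> 'a set" where
  "inverse_operator S y = {x. y \<in> S x}"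

text \<open>The resolvent \<open>(I + S)\<^sup>-\<^sup>1\<close> is read as a function: for maximal monotone \<open>S\<close> on a Hilbert space
  every value of the inverse is a singleton (Minty). Elsewhere \<^const>\<open>the_elem\<close> may be
  unspecified.\<close>

definition resolvent :: "('a::real_inner \<Rightarrow> 'a set) \<Rightarrow> 'a \<Rightarrow> 'a" where
  "resolvent S y = the_elem (inverse_operator (id_plus S) y)"

definition splitting_map ::
  "real \<Rightarrow> ('a::real_inner \<Rightarrow> 'a set) \<Rightarrow> ('a \<Rightarrow> 'a set) \<Rightarrow> ('a \<Rightarrow> 'a) \<Rightarrow> 'a \<Rightarrow> 'a" where
  "splitting_map \<gamma> A B C z =
     (let JA = resolvent (scale_operator \<gamma> A); JB = resolvent (scale_operator \<gamma> B)
      in z - JB z + JA (2 *\<^sub>R JB z - z - \<gamma> *\<^sub>R C (JB z)))"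

end

theory Submission
  imports Defs
begin

text \<open>Write \<open>d = z - z\<^sup>*\<close>, \<open>w = z - Tz\<close>, let \<open>p\<close>, \<open>q\<close> be the differences of the two resolvent
  points from \<open>J\<^bsub>\<gamma>B\<^esub> z\<^sup>*\<close>, and \<open>a\<close>, \<open>b\<close>, \<open>c\<close> the corresponding differences of values of
  \<open>\<gamma>A\<close>, \<open>\<gamma>B\<close>, \<open>\<gamma>C\<close>. Then \<open>d = p + b\<close> and \<open>w = p - q = a + b + c\<close>, and expanding
  \<open>\<parallel>d - \<lambda>w\<parallel>\<^sup>2\<close> shows that one step decreases \<open>\<parallel>d\<parallel>\<^sup>2\<close> by at least \<open>\<lambda>\<close> times
  \<open>2\<langle>q,a\<rangle> + 2\<langle>p,b\<rangle> + (2 - \<epsilon> - \<lambda>)\<parallel>w\<parallel>\<^sup>2 + (2\<langle>p,c\<rangle> - \<parallel>c\<parallel>\<^sup>2/\<epsilon>)\<close>. In each of the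
  six cases strong monotonicity bounds this from below, and the Lipschitz condition lets one
  bound \<open>\<parallel>d\<parallel>\<^sup>2\<close> from above, by the same squares among \<open>\<parallel>p\<parallel>\<^sup>2\<close>, \<open>\<parallel>q\<parallel>\<^sup>2\<close>, \<open>\<parallel>w\<parallel>\<^sup>2\<close>,
  \<open>\<parallel>c\<parallel>\<^sup>2\<close>. That the resolvents are everywhere defined is Minty's theorem.\<close>

section \<open>Resolvents of maximal monotone operators\<close>

text \<open>The supremum of the affine functions may be infinite, so it is represented by its upper
  bounds \<open>s\<close>. Half the squared norm makes the objective strongly convex: sublevel sets
  close to the infimum have small diameter, and completeness provides a common point.\<close>

lemma minimizer_sup_affine_plus_square:
  fixes a :: "'i \<Rightarrow> 'a::{real_inner, complete_space}" and k :: "'i \<Rightarrow> real"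
  assumes "i\<^sub>0 \<in> I" and proper: "\<And>i. i \<in> I \<Longrightarrow> inner (a i) w\<^sub>1 - k i \<le> s\<^sub>1"
  obtains w\<^sub>0 s\<^sub>0 where
    "\<And>i. i \<in> I \<Longrightarrow> inner (a i) w\<^sub>0 - k i \<le> s\<^sub>0"
    "\<And>w s. (\<And>i. i \<in> I \<Longrightarrow> inner (a i) w - k i \<le> s)
       \<Longrightarrow> s\<^sub>0 + (norm w\<^sub>0)\<^sup>2 / 2 \<le> s + (norm w)\<^sup>2 / 2"
proof -
  define h where "h i w = inner (a i) w - k i + (norm w)\<^sup>2 / 2" for i w
  define K where "K r = {w. \<forall>i\<in>I. h i w \<le> r}" for r
  define R where "R = {r. K r \<noteq> {}}"
  define m where "m = Inf R"
  have "w\<^sub>1 \<in> K (s\<^sub>1 + (norm w\<^sub>1)\<^sup>2 / 2)"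
    using proper by (simp add: K_def h_def)
  then have R_ne: "R \<noteq> {}"
    by (auto simp: R_def)
  \<comment> \<open>Completing the square bounds each \<open>h i\<close> from below; a single index
    then makes the infimum \<open>m\<close> finite.\<close>
  have h_lower: "- k i - (norm (a i))\<^sup>2 / 2 \<le> h i w" for i w
  proof -
    have "0 \<le> (norm (a i + w))\<^sup>2" by simp
    also have "\<dots> = (norm (a i))\<^sup>2 + 2 * inner (a i) w + (norm w)\<^sup>2"
      by (simp add: power2_norm_eq_inner inner_simps inner_commute)
    finally show ?thesis by (simp add: h_def field_simps)
  qed
  have R_bdd: "bdd_below R"
  proof (rule bdd_belowI)
    fix r assume "r \<in> R"
    then obtain w where "h i\<^sub>0 w \<le> r"
      using \<open>i\<^sub>0 \<in> I\<close> by (auto simp: R_def K_def)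
    then show "- k i\<^sub>0 - (norm (a i\<^sub>0))\<^sup>2 / 2 \<le> r"
      using h_lower[of i\<^sub>0 w] by linarith
  qed
  have m_le: "m \<le> r" if "w \<in> K r" for w r
    unfolding m_def by (rule cInf_lower[OF _ R_bdd]) (use that in \<open>auto simp: R_def\<close>)
  have K_ne: "K r \<noteq> {}" if "m < r" for r
  proof -
    obtain r' where "r' \<in> R" "r' < r"
      using cInf_lessD[OF R_ne \<open>m < r\<close>[unfolded m_def]] by blast
    then obtain w where "w \<in> K r'" by (auto simp: R_def)
    then have "w \<in> K r" using \<open>r' < r\<close> by (force simp: K_def)
    then show ?thesis by blast
  qed
  \<comment> \<open>The affine part is exact at midpoints, and the parallelogram law yields the gain
    for the quadratic part.\<close>
  have midpoint: "h i ((1/2) *\<^sub>R (x + y)) = (h i x + h i y) / 2 - (norm (x - y))\<^sup>2 / 8" for i x y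
    by (simp add: h_def power2_norm_eq_inner inner_simps inner_commute field_simps)
  \<comment> \<open>The midpoint lies in a sublevel set whose level is lower by an eighth of the
    squared distance, and no nonempty one has level below \<open>m\<close>.\<close>
  have K_diam: "(norm (x - y))\<^sup>2 \<le> 8 * (r - m)" if "x \<in> K r" "y \<in> K r" for x y r
  proof -
    have "(1/2) *\<^sub>R (x + y) \<in> K (r - (norm (x - y))\<^sup>2 / 8)"
      using that unfolding K_def by (force simp: midpoint)
    from m_le[OF this] show ?thesis by simp
  qed
  have K_closed: "closed (K r)" for r
  proof -
    have "K r = (\<Inter>i\<in>I. {w. h i w \<le> r})" by (auto simp: K_def)
    moreover have "closed {w. h i w \<le> r}" for i
      unfolding h_def by (intro closed_Collect_le continuous_intros) auto
    ultimately show ?thesis by auto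
  qed
  define r where "r n = m + 1 / real (Suc n)" for n
  have r_gt: "m < r n" for n by (simp add: r_def)
  have r_lim: "r \<longlonglongrightarrow> m"
    unfolding r_def using tendsto_add[OF tendsto_const LIMSEQ_Suc[OF lim_1_over_n]]
    by fastforce
  \<comment> \<open>Cantor's intersection theorem along levels decreasing to
    \<open>m\<close>.\<close>
  obtain w\<^sub>0 where w0: "\<And>n. w\<^sub>0 \<in> K (r n)"
  proof (rule decreasing_closed_nest[of "\<lambda>n. K (r n)"])
    show "K (r n) \<subseteq> K (r l)" if "l \<le> n" for l n
    proof -
      have "r n \<le> r l" using that by (simp add: r_def frac_le)
      then show ?thesis by (force simp: K_def)
    qed
    fix e :: real assume "0 < e"
    then have "\<forall>\<^sub>F n in sequentially. r n < m + e\<^sup>2 / 8"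
      by (intro order_tendstoD(2)[OF r_lim]) simp
    then obtain n where n: "r n < m + e\<^sup>2 / 8"
      by (auto simp: eventually_sequentially)
    have "dist x y < e" if "x \<in> K (r n)" "y \<in> K (r n)" for x y
    proof -
      have "(norm (x - y))\<^sup>2 < e\<^sup>2" using K_diam[OF that] n by argo
      then show ?thesis using \<open>0 < e\<close> by (simp add: dist_norm power2_less_imp_less)
    qed
    then show "\<exists>n. \<forall>x\<in>K (r n). \<forall>y\<in>K (r n). dist x y < e" by blast
  qed (use K_closed K_ne r_gt in auto)
  have "h i w\<^sub>0 \<le> m" if "i \<in> I" for i
    by (rule LIMSEQ_le_const[OF r_lim]) (use w0 that in \<open>auto simp: K_def\<close>)
  then have "inner (a i) w\<^sub>0 - k i \<le> m - (norm w\<^sub>0)\<^sup>2 / 2" if "i \<in> I" for i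
    using that by (force simp: h_def)
  moreover have "m - (norm w\<^sub>0)\<^sup>2 / 2 + (norm w\<^sub>0)\<^sup>2 / 2 \<le> s + (norm w)\<^sup>2 / 2"
    if "\<And>i. i \<in> I \<Longrightarrow> inner (a i) w - k i \<le> s" for w s
    using that by (auto intro!: m_le[of w] simp: K_def h_def)
  ultimately show thesis by (rule that)
qed

section \<open>Minty's theorem by way of the Fitzpatrick function\<close>

lemma nonneg_if_nonneg_perturbed:
  fixes x y :: real
  assumes "\<And>t. 0 < t \<Longrightarrow> t \<le> 1 \<Longrightarrow> 0 \<le> t * x + t\<^sup>2 * y"
  shows "0 \<le> x"
\<comment> \<open>Divide the assumption by \<open>t\<close> and let \<open>t\<close> decrease to
  0.\<close>
proof (rule tendsto_lowerbound)
  show "((\<lambda>t. x + t * y) \<longlongrightarrow> x) (at_right 0)"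
    by (auto intro!: tendsto_eq_intros)
  have "0 \<le> x + t * y" if "0 < t" "t \<le> 1" for t
  proof -
    have "0 \<le> t * (x + t * y)"
      using assms[OF that] by (simp add: algebra_simps power2_eq_square)
    then show ?thesis using that by (simp add: zero_le_mult_iff)
  qed
  then show "\<forall>\<^sub>F t in at_right 0. 0 \<le> x + t * y"
    unfolding eventually_at_right_field by (intro exI[of _ 1]) auto
qed simp

text \<open>The Simons--Zalinescu argument: the function \<open>F\<close> that is minimized together with half the
  squared norm is the Fitzpatrick function of \<open>G\<close>, which dominates the duality pairing and
  agrees with it on \<open>G\<close>.\<close>

theorem minty:
  fixes G :: "('a::{real_inner, complete_space} \<times> 'a) set"
  assumes maximal: "\<And>x u. (x, u) \<in> G \<longleftrightarrow> (\<forall>(y, v)\<in>G. 0 \<le> inner (x - y) (u - v))"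
  shows "\<exists>x. (x, - x) \<in> G"
proof -
  \<comment> \<open>For empty \<open>G\<close> the right-hand side of \<open>maximal\<close> would
    be vacuous and would put (0, 0) into \<open>G\<close>.\<close>
  have "G \<noteq> {}"
    using maximal[of 0 0] by auto
  then obtain y\<^sub>1 v\<^sub>1 where g1: "(y\<^sub>1, v\<^sub>1) \<in> G" by auto
  \<comment> \<open>\<open>F g\<close> is a single affine piece, with gradient
    \<open>prod.swap g\<close>. The Fitzpatrick function is the supremum over \<open>g\<close> in
    \<open>G\<close> and enters only through its upper bounds.\<close>
  define F where "F g w = inner (prod.swap g) w - inner (fst g) (snd g)" for g w :: "'a \<times> 'a"
  have F_simp: "F (y, v) (x, u) = inner x v + inner y u - inner y v" for x u y v
    by (simp add: F_def inner_commute)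
  have F_graph: "F g (x, u) \<le> inner x u" if "(x, u) \<in> G" "g \<in> G" for g x u
  proof -
    obtain y v where g: "g = (y, v)" by fastforce
    have "0 \<le> inner (x - y) (u - v)" using that maximal[of x u] g by auto
    then show ?thesis by (simp add: g F_simp inner_simps)
  qed
  \<comment> \<open>For g = (y, v), \<open>F g (x, u)\<close> is
    \<open>inner x u - inner (x - y) (u - v)\<close>. On the graph take g = (x, u); off the graph,
    maximality supplies a g that makes the subtracted product negative.\<close>
  have F_ge: "inner x u \<le> s" if "\<And>g. g \<in> G \<Longrightarrow> F g (x, u) \<le> s" for x u s
  proof (cases "(x, u) \<in> G")
    case True
    from that[OF this] show ?thesis by (simp add: F_simp)
  next
    case False
    then have "\<not> (\<forall>(y, v)\<in>G. 0 \<le> inner (x - y) (u - v))"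
      using maximal[of x u] by simp
    then obtain y v where yv: "(y, v) \<in> G" "inner (x - y) (u - v) < 0"
      by (auto simp: not_le)
    from yv(2) that[OF yv(1)] show ?thesis by (simp add: F_simp inner_simps)
  qed
  obtain w\<^sub>0 s\<^sub>0 where w0: "\<And>g. g \<in> G \<Longrightarrow> F g w\<^sub>0 \<le> s\<^sub>0"
    and least: "\<And>w s. (\<And>g. g \<in> G \<Longrightarrow> F g w \<le> s)
      \<Longrightarrow> s\<^sub>0 + (norm w\<^sub>0)\<^sup>2 / 2 \<le> s + (norm w)\<^sup>2 / 2"
    using minimizer_sup_affine_plus_square[OF g1, of prod.swap "(y\<^sub>1, v\<^sub>1)"
        "\<lambda>g. inner (fst g) (snd g)" "inner y\<^sub>1 v\<^sub>1"] F_graph[OF g1]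
    unfolding F_def by blast
  obtain x\<^sub>0 u\<^sub>0 where xu: "w\<^sub>0 = (x\<^sub>0, u\<^sub>0)" by fastforce
  \<comment> \<open>The first-order condition at the minimizer: move from \<open>w\<^sub>0\<close>
    towards \<open>w\<close> by a fraction \<open>t\<close>. Since each \<open>F g\<close> is
    affine, the upper bounds interpolate linearly, and the quadratic remainder vanishes in the
    limit.\<close>
  have optimality: "s\<^sub>0 + (norm w\<^sub>0)\<^sup>2 \<le> s + inner w\<^sub>0 w"
    if w: "\<And>g. g \<in> G \<Longrightarrow> F g w \<le> s" for w s
  proof -
    have "0 \<le> (s - s\<^sub>0 + inner w\<^sub>0 (w - w\<^sub>0))"
    proof (rule nonneg_if_nonneg_perturbed)
      fix t :: real assume t: "0 < t" "t \<le> 1"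
      let ?w = "w\<^sub>0 + t *\<^sub>R (w - w\<^sub>0)"
      have "F g ?w \<le> (1 - t) * s\<^sub>0 + t * s" if "g \<in> G" for g
      proof -
        have "F g ?w = (1 - t) * F g w\<^sub>0 + t * F g w"
          by (simp add: F_def inner_simps algebra_simps)
        also have "\<dots> \<le> (1 - t) * s\<^sub>0 + t * s"
          using w0[OF that] w[OF that] t by (intro add_mono mult_left_mono) auto
        finally show ?thesis .
      qed
      from least[of ?w, OF this]
      have "s\<^sub>0 + (norm w\<^sub>0)\<^sup>2 / 2 \<le> (1 - t) * s\<^sub>0 + t * s + (norm ?w)\<^sup>2 / 2" .
      moreover have "(norm ?w)\<^sup>2 = (norm w\<^sub>0)\<^sup>2 + 2 * t * inner w\<^sub>0 (w - w\<^sub>0)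
          + t\<^sup>2 * (norm (w - w\<^sub>0))\<^sup>2"
        unfolding power2_norm_eq_inner
        by (simp add: inner_simps inner_commute algebra_simps power2_eq_square)
      ultimately show "0 \<le> t * (s - s\<^sub>0 + inner w\<^sub>0 (w - w\<^sub>0)) + t\<^sup>2 * ((norm (w - w\<^sub>0))\<^sup>2 / 2)"
        by (simp add: algebra_simps)
    qed
    then show ?thesis by (simp add: inner_simps power2_norm_eq_inner)
  qed
  \<comment> \<open>Test optimality with a point of the graph, where the pairing is an upper bound,
    and bound \<open>s\<^sub>0\<close> below by the pairing at the minimizer. Adding
    \<open>inner x\<^sub>0 u\<^sub>0\<close> to both sides completes the square on the left and the
    product on the right.\<close>
  have key: "(norm (x\<^sub>0 + u\<^sub>0))\<^sup>2 \<le> inner (- u\<^sub>0 - y) (- x\<^sub>0 - v)" if "(y, v) \<in> G" for y v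
  proof -
    have "s\<^sub>0 + (norm w\<^sub>0)\<^sup>2 \<le> inner y v + inner w\<^sub>0 (y, v)"
      by (rule optimality) (rule F_graph[OF that])
    moreover have "inner x\<^sub>0 u\<^sub>0 \<le> s\<^sub>0"
      by (rule F_ge) (use w0 xu in auto)
    ultimately show ?thesis
      by (simp add: xu power2_norm_eq_inner inner_simps inner_commute)
  qed
  have "(- u\<^sub>0, - x\<^sub>0) \<in> G"
    unfolding maximal[of "- u\<^sub>0"] using key by (fastforce intro: order_trans[OF zero_le_power2])
  \<comment> \<open>At the point (- \<open>u\<^sub>0\<close>, - \<open>x\<^sub>0\<close>) itself the
    right side of \<open>key\<close> is 0, which forces
    \<open>x\<^sub>0 + u\<^sub>0 = 0\<close>.\<close>
  moreover from key[OF this] have "- u\<^sub>0 = x\<^sub>0"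
    by (simp add: add_eq_0_iff2)
  ultimately show ?thesis by auto
qed

text \<open>A pair monotonically related to the whole graph can be added to it without losing
  monotonicity, so by maximality it already belongs to the graph.\<close>

lemma maximal_monotone_iff:
  assumes "maximal_monotone S"
  shows "u \<in> S x \<longleftrightarrow> (\<forall>y. \<forall>v\<in>S y. 0 \<le> inner (x - y) (u - v))"
proof
  assume "u \<in> S x"
  then show "\<forall>y. \<forall>v\<in>S y. 0 \<le> inner (x - y) (u - v)"
    using assms by (auto simp: maximal_monotone_def monotone_operator_def)
next
  assume *: "\<forall>y. \<forall>v\<in>S y. 0 \<le> inner (x - y) (u - v)"
  define R where "R = S(x := insert u (S x))"
  have "0 \<le> inner (y - x) (v - u)" if "v \<in> S y" for y v
    using *[rule_format, OF that] by (simp add: inner_simps)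
  then have "monotone_operator R"
    using * assms by (auto simp: R_def maximal_monotone_def monotone_operator_def)
  moreover have "\<forall>y. S y \<subseteq> R y" by (auto simp: R_def)
  ultimately have "R = S" using assms by (auto simp: maximal_monotone_def)
  then show "u \<in> S x" unfolding R_def by (metis fun_upd_same insertI1)
qed

text \<open>This turns the resolvent, defined through \<open>the_elem\<close>, into a usable
  equation: Minty's theorem gives existence, and monotonicity gives the uniqueness that makes the
  inverse image a singleton.\<close>

lemma resolvent_decomposition:
  fixes S :: "'a::{real_inner, complete_space} \<Rightarrow> 'a set"
  assumes S: "maximal_monotone S" and "0 < \<gamma>"
  obtains u where "u \<in> S (resolvent (scale_operator \<gamma> S) z)"
    and "z = resolvent (scale_operator \<gamma> S) z + \<gamma> *\<^sub>R u"
proof -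
  \<comment> \<open>The graph of \<gamma>S - z. A point (x, -x) on it satisfies -x = \<gamma>u - z
    with u in S x, which is the desired decomposition. Shifting by z and scaling by \<gamma> > 0
    preserve maximality.\<close>
  define G where "G = {(x, w). (1 / \<gamma>) *\<^sub>R (w + z) \<in> S x}"
  have G_iff: "(x, \<gamma> *\<^sub>R u - z) \<in> G \<longleftrightarrow> u \<in> S x" for x u
    using \<open>0 < \<gamma>\<close> by (simp add: G_def)
  have ex_u: "\<exists>u. w = \<gamma> *\<^sub>R u - z" for w
    using \<open>0 < \<gamma>\<close> by (intro exI[of _ "(1 / \<gamma>) *\<^sub>R (w + z)"]) simp
  have scaled: "0 \<le> inner (x - y) (\<gamma> *\<^sub>R u - z - (\<gamma> *\<^sub>R v - z)) \<longleftrightarrow> 0 \<le> inner (x - y) (u - v)"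
    for x y u v
  proof -
    have "\<gamma> *\<^sub>R u - z - (\<gamma> *\<^sub>R v - z) = \<gamma> *\<^sub>R (u - v)" by (simp add: algebra_simps)
    then show ?thesis using \<open>0 < \<gamma>\<close> by (simp add: zero_le_mult_iff)
  qed
  have "(x, w) \<in> G \<longleftrightarrow> (\<forall>(y, v)\<in>G. 0 \<le> inner (x - y) (w - v))" for x w
  proof -
    obtain u where w: "w = \<gamma> *\<^sub>R u - z" using ex_u by blast
    have "(\<forall>(y, v)\<in>G. 0 \<le> inner (x - y) (w - v))
        \<longleftrightarrow> (\<forall>y v. (y, \<gamma> *\<^sub>R v - z) \<in> G \<longrightarrow> 0 \<le> inner (x - y) (w - (\<gamma> *\<^sub>R v - z)))"
      using ex_u by (auto, metis)
    then show ?thesis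
      unfolding w G_iff scaled maximal_monotone_iff[OF S, of u x] by blast
  qed
  then obtain x where "(x, - x) \<in> G" using minty by blast
  moreover obtain u where u: "- x = \<gamma> *\<^sub>R u - z" using ex_u by blast
  ultimately have uS: "u \<in> S x" by (simp add: G_iff)
  have z: "z = x + \<gamma> *\<^sub>R u" using u by (simp add: algebra_simps)
  \<comment> \<open>Two decompositions of z have y - x = -\<gamma>(v - u), so monotonicity leaves
    only v = u.\<close>
  have unique: "y = x" if "v \<in> S y" "z = y + \<gamma> *\<^sub>R v" for y v
  proof -
    have "0 \<le> inner (y - x) (v - u)"
      using maximal_monotone_iff[OF S] uS that(1) by blast
    moreover have "y - x = - (\<gamma> *\<^sub>R (v - u))"
      using z that(2) by (simp add: algebra_simps)
    ultimately have "\<gamma> * inner (v - u) (v - u) \<le> 0" by simp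
    then have "inner (v - u) (v - u) \<le> 0"
      using \<open>0 < \<gamma>\<close> by (simp add: mult_le_0_iff)
    then have "v = u"
      by (metis eq_iff_diff_eq_0 inner_ge_zero inner_eq_zero_iff order_antisym)
    then show ?thesis using z that(2) by simp
  qed
  have "inverse_operator (id_plus (scale_operator \<gamma> S)) z = {x}"
    unfolding inverse_operator_def id_plus_def scale_operator_def
    using uS z unique by auto
  then have "resolvent (scale_operator \<gamma> S) z = x" by (simp add: resolvent_def)
  with that uS z show thesis by simp
qed

section \<open>The splitting iteration\<close>

lemma splitting_map_decomposition:
  fixes A B :: "'a::{real_inner, complete_space} \<Rightarrow> 'a set"
  assumes "maximal_monotone A" "maximal_monotone B" "0 < \<gamma>"
  obtains x y u v where "v \<in> B x" "u \<in> A y" "z = x + \<gamma> *\<^sub>R v"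
    and "x - y = \<gamma> *\<^sub>R u + \<gamma> *\<^sub>R v + \<gamma> *\<^sub>R C x"
    and "splitting_map \<gamma> A B C z = z - (x - y)"
proof -
  define x where "x = resolvent (scale_operator \<gamma> B) z"
  \<comment> \<open>The argument at which the resolvent of \<gamma>A is evaluated.\<close>
  define t where "t = 2 *\<^sub>R x - z - \<gamma> *\<^sub>R C x"
  define y where "y = resolvent (scale_operator \<gamma> A) t"
  obtain v where v: "v \<in> B x" "z = x + \<gamma> *\<^sub>R v"
    using resolvent_decomposition[OF assms(2,3), of z] unfolding x_def by blast
  obtain u where u: "u \<in> A y" "t = y + \<gamma> *\<^sub>R u"
    using resolvent_decomposition[OF assms(1,3), of t] unfolding y_def by blast
  have "x - y = \<gamma> *\<^sub>R u + (z - x) + \<gamma> *\<^sub>R C x"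
    using u(2) unfolding t_def by (simp add: algebra_simps scaleR_2)
  then have "x - y = \<gamma> *\<^sub>R u + \<gamma> *\<^sub>R v + \<gamma> *\<^sub>R C x"
    using v(2) by simp
  moreover have "splitting_map \<gamma> A B C z = z - (x - y)"
    by (simp add: splitting_map_def Let_def x_def y_def t_def)
  ultimately show thesis using that v u(1) by blast
qed

section \<open>Differences between an arbitrary point and the fixed point\<close>

lemma maximal_monotone_inner_nonneg:
  "maximal_monotone S \<Longrightarrow> u \<in> S x \<Longrightarrow> v \<in> S y \<Longrightarrow> 0 \<le> inner (x - y) (u - v)"
  using maximal_monotone_iff[of S u x] by blast

lemma lipschitz_operator_bound:
  assumes "lipschitz_operator L S" "u \<in> S x" "v \<in> S y"
  shows "0 \<le> L" "norm (u - v) \<le> L * norm (x - y)"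
proof -
  obtain f where f: "\<And>x. S x = {f x}" "L-lipschitz_on UNIV f"
    using assms(1) unfolding lipschitz_operator_def by blast
  show "0 \<le> L" using f(2) lipschitz_on_nonneg by blast
  show "norm (u - v) \<le> L * norm (x - y)"
    using f assms(2,3) by (auto simp: lipschitz_on_def dist_norm)
qed

text \<open>The strong monotonicity and Lipschitz bounds are conclusions in the form of
  implications, so that one choice of vectors serves all six cases. The vectors \<open>a\<close>,
  \<open>b\<close>, \<open>c\<close> absorb the factor \<gamma>.\<close>

lemma splitting_map_differences:
  fixes A B :: "'a::{real_inner, complete_space} \<Rightarrow> 'a set"
  assumes A: "maximal_monotone A" and B: "maximal_monotone B" and C: "cocoercive \<beta> C"
    and "0 < \<gamma>" and zstar: "splitting_map \<gamma> A B C zstar = zstar"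
  obtains p q a b c where
    "z - zstar = p + b" "splitting_map \<gamma> A B C z - zstar = p + b - (p - q)" "p - q = a + b + c"
    "0 \<le> inner q a" "0 \<le> inner p b" "\<beta> / \<gamma> * (norm c)\<^sup>2 \<le> inner p c"
    "\<And>\<mu>. strongly_monotone \<mu> A \<Longrightarrow> \<gamma> * \<mu> * (norm q)\<^sup>2 \<le> inner q a"
    "\<And>\<mu>. strongly_monotone \<mu> B \<Longrightarrow> \<gamma> * \<mu> * (norm p)\<^sup>2 \<le> inner p b"
    "\<And>\<mu>. strongly_monotone \<mu> (\<lambda>x. {C x}) \<Longrightarrow> \<gamma> * \<mu> * (norm p)\<^sup>2 \<le> inner p c"
    "\<And>L. lipschitz_operator L A \<Longrightarrow> 0 \<le> L \<and> norm a \<le> \<gamma> * L * norm q"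
    "\<And>L. lipschitz_operator L B \<Longrightarrow> 0 \<le> L \<and> norm b \<le> \<gamma> * L * norm p"
proof -
  obtain x y u v where 1: "v \<in> B x" "u \<in> A y" "z = x + \<gamma> *\<^sub>R v"
    "x - y = \<gamma> *\<^sub>R u + \<gamma> *\<^sub>R v + \<gamma> *\<^sub>R C x" "splitting_map \<gamma> A B C z = z - (x - y)"
    by (rule splitting_map_decomposition[OF A B \<open>0 < \<gamma>\<close>, of z C])
  obtain x' y' u' v' where 2: "v' \<in> B x'" "u' \<in> A y'" "zstar = x' + \<gamma> *\<^sub>R v'"
    "x' - y' = \<gamma> *\<^sub>R u' + \<gamma> *\<^sub>R v' + \<gamma> *\<^sub>R C x'"
    "splitting_map \<gamma> A B C zstar = zstar - (x' - y')"
    by (rule splitting_map_decomposition[OF A B \<open>0 < \<gamma>\<close>, of zstar C])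
  \<comment> \<open>At a fixed point both resolvent points coincide, so \<open>p\<close> and
    \<open>q\<close> are measured from the same point and \<open>p - q\<close> is the full
    residual.\<close>
  have fixed: "x' = y'" using 2(5) zstar by simp
  have scale: "\<gamma> * \<mu> * r \<le> inner s (\<gamma> *\<^sub>R t)" if "\<mu> * r \<le> inner s t" for \<mu> r and s t :: 'a
    using mult_left_mono[OF that, of \<gamma>] \<open>0 < \<gamma>\<close> by (simp add: mult.assoc)
  have scale_norm: "norm (\<gamma> *\<^sub>R t) \<le> \<gamma> * L * r" if "norm t \<le> L * r" for t :: 'a and L r
    using mult_left_mono[OF that, of \<gamma>] \<open>0 < \<gamma>\<close> by (simp add: mult.assoc)
  show thesis
  proof (rule that[of "x - x'" "\<gamma> *\<^sub>R (v - v')" "y - y'" "\<gamma> *\<^sub>R (u - u')" "\<gamma> *\<^sub>R (C x - C x')"])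
    show d: "z - zstar = x - x' + \<gamma> *\<^sub>R (v - v')"
      using 1(3) 2(3) by (simp add: algebra_simps)
    have "splitting_map \<gamma> A B C z - zstar = (z - zstar) - (x - x' - (y - y'))"
      using 1(5) fixed by simp
    then show "splitting_map \<gamma> A B C z - zstar
        = x - x' + \<gamma> *\<^sub>R (v - v') - (x - x' - (y - y'))"
      unfolding d .
    have "x - x' - (y - y') = (x - y) - (x' - y')" by simp
    also have "\<dots> = \<gamma> *\<^sub>R (u - u') + \<gamma> *\<^sub>R (v - v') + \<gamma> *\<^sub>R (C x - C x')"
      unfolding 1(4) 2(4) by (simp add: algebra_simps)
    finally show "x - x' - (y - y')
        = \<gamma> *\<^sub>R (u - u') + \<gamma> *\<^sub>R (v - v') + \<gamma> *\<^sub>R (C x - C x')" .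
    show "0 \<le> inner (y - y') (\<gamma> *\<^sub>R (u - u'))"
      using maximal_monotone_inner_nonneg[OF A 1(2) 2(2)] \<open>0 < \<gamma>\<close> by simp
    show "0 \<le> inner (x - x') (\<gamma> *\<^sub>R (v - v'))"
      using maximal_monotone_inner_nonneg[OF B 1(1) 2(1)] \<open>0 < \<gamma>\<close> by simp
    have "\<beta> * (norm (C x - C x'))\<^sup>2 \<le> inner (x - x') (C x - C x')"
      using C by (simp add: cocoercive_def inner_commute)
    \<comment> \<open>The squared norm of \<open>c\<close> carries \<gamma> twice and the inner
      product only once, whence the constant \<beta>/\<gamma>.\<close>
    moreover have "\<beta> / \<gamma> * (norm (\<gamma> *\<^sub>R (C x - C x')))\<^sup>2 = \<gamma> * \<beta> * (norm (C x - C x'))\<^sup>2"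
      using \<open>0 < \<gamma>\<close> by (simp add: power_mult_distrib power2_eq_square)
    ultimately show "\<beta> / \<gamma> * (norm (\<gamma> *\<^sub>R (C x - C x')))\<^sup>2
        \<le> inner (x - x') (\<gamma> *\<^sub>R (C x - C x'))"
      using scale by presburger
  next
    fix \<mu> assume "strongly_monotone \<mu> A"
    then show "\<gamma> * \<mu> * (norm (y - y'))\<^sup>2 \<le> inner (y - y') (\<gamma> *\<^sub>R (u - u'))"
      using 1(2) 2(2) by (intro scale) (auto simp: strongly_monotone_def)
  next
    fix \<mu> assume "strongly_monotone \<mu> B"
    then show "\<gamma> * \<mu> * (norm (x - x'))\<^sup>2 \<le> inner (x - x') (\<gamma> *\<^sub>R (v - v'))"
      using 1(1) 2(1) by (intro scale) (auto simp: strongly_monotone_def)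
  next
    fix \<mu> assume "strongly_monotone \<mu> (\<lambda>x. {C x})"
    then show "\<gamma> * \<mu> * (norm (x - x'))\<^sup>2 \<le> inner (x - x') (\<gamma> *\<^sub>R (C x - C x'))"
      by (intro scale) (auto simp: strongly_monotone_def)
  next
    fix L assume L: "lipschitz_operator L A"
    show "0 \<le> L \<and> norm (\<gamma> *\<^sub>R (u - u')) \<le> \<gamma> * L * norm (y - y')"
      using lipschitz_operator_bound[OF L 1(2) 2(2)] scale_norm by blast
  next
    fix L assume L: "lipschitz_operator L B"
    show "0 \<le> L \<and> norm (\<gamma> *\<^sub>R (v - v')) \<le> \<gamma> * L * norm (x - x')"
      using lipschitz_operator_bound[OF L 1(1) 2(1)] scale_norm by blast
  qed
qed

lemma relaxed_step_estimate:
  fixes p q a b c :: "'a::real_inner"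
  assumes w: "p - q = a + b + c" and "0 < \<epsilon>" "0 \<le> \<kappa>"
  shows "(norm (p + b - \<kappa> *\<^sub>R (p - q)))\<^sup>2 \<le> (norm (p + b))\<^sup>2
    - \<kappa> * (2 * inner q a + 2 * inner p b + (2 - \<epsilon> - \<kappa>) * (norm (p - q))\<^sup>2
        + (2 * inner p c - (norm c)\<^sup>2 / \<epsilon>))"
proof -
  let ?w = "p - q"
  have eq: "(norm (p + b - \<kappa> *\<^sub>R ?w))\<^sup>2
      = (norm (p + b))\<^sup>2 - 2 * \<kappa> * inner (p + b) ?w + \<kappa>\<^sup>2 * (norm ?w)\<^sup>2"
    unfolding power2_norm_eq_inner
    by (simp add: inner_simps inner_commute algebra_simps power2_eq_square)
  have "q = p - (a + b + c)" using w by (simp add: algebra_simps)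
  \<comment> \<open>With w = p - q, write \<open>inner p a\<close> as
    \<open>inner q a + inner w a\<close>; then \<open>inner w (a + b)\<close> is the squared norm of
    w minus \<open>inner w c\<close>.\<close>
  then have dw: "inner (p + b) ?w
      = inner q a + inner p b + inner p c + (norm ?w)\<^sup>2 - inner ?w c"
    unfolding power2_norm_eq_inner by (simp add: inner_simps inner_commute)
  \<comment> \<open>Young's inequality with weight \<epsilon>: this is where 2 becomes 2 -
    \<epsilon> in the coefficient of the residual.\<close>
  have "0 \<le> (norm (\<epsilon> *\<^sub>R ?w - c))\<^sup>2 / \<epsilon>" using \<open>0 < \<epsilon>\<close> by simp
  also have "\<dots> = \<epsilon> * (norm ?w)\<^sup>2 - 2 * inner ?w c + (norm c)\<^sup>2 / \<epsilon>"
    unfolding power2_norm_eq_inner using \<open>0 < \<epsilon>\<close>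
    by (simp add: inner_simps inner_commute field_simps)
  finally have young: "2 * inner ?w c \<le> \<epsilon> * (norm ?w)\<^sup>2 + (norm c)\<^sup>2 / \<epsilon>" by simp
  have "2 * inner q a + 2 * inner p b + (2 - \<epsilon> - \<kappa>) * (norm ?w)\<^sup>2
      + (2 * inner p c - (norm c)\<^sup>2 / \<epsilon>) \<le> 2 * inner (p + b) ?w - \<kappa> * (norm ?w)\<^sup>2"
    unfolding dw using young by (simp add: algebra_simps)
  from mult_left_mono[OF this \<open>0 \<le> \<kappa>\<close>] show ?thesis
    unfolding eq by (simp add: algebra_simps power2_eq_square)
qed

section \<open>Elementary inequalities for squared norms of sums\<close>

lemma norm_add_power2_le:
  fixes x y :: "'a::real_inner"
  shows "(norm (x + y))\<^sup>2 \<le> 2 * ((norm x)\<^sup>2 + (norm y)\<^sup>2)"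
proof -
  have "0 \<le> (norm (x - y))\<^sup>2" by simp
  then show ?thesis unfolding power2_norm_eq_inner by (simp add: inner_simps inner_commute)
qed

lemma norm_add3_power2_le:
  fixes x y z :: "'a::real_inner"
  shows "(norm (x + y + z))\<^sup>2 \<le> 3 * ((norm x)\<^sup>2 + (norm y)\<^sup>2 + (norm z)\<^sup>2)"
proof -
  have "0 \<le> (norm (x - y))\<^sup>2 + (norm (y - z))\<^sup>2 + (norm (x - z))\<^sup>2" by simp
  then show ?thesis unfolding power2_norm_eq_inner by (simp add: inner_simps inner_commute)
qed

lemma norm_add4_power2_le:
  fixes x y z t :: "'a::real_inner"
  shows "(norm (x + y + z + t))\<^sup>2
    \<le> 4 * ((norm x)\<^sup>2 + (norm y)\<^sup>2 + (norm z)\<^sup>2 + (norm t)\<^sup>2)"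
  using norm_add_power2_le[of "x + y" "z + t"] norm_add_power2_le[of x y] norm_add_power2_le[of z t]
  by (simp add: add.assoc)

lemma norm_power2_le:
  fixes x :: "'a::real_normed_vector"
  shows "norm x \<le> r * s \<Longrightarrow> (norm x)\<^sup>2 \<le> r\<^sup>2 * s\<^sup>2"
  by (metis norm_ge_zero power_mono power_mult_distrib)

lemma norm_add_power2_le_lipschitz:
  fixes x y :: "'a::real_normed_vector"
  assumes "norm y \<le> r * norm x"
  shows "(norm (x + y))\<^sup>2 \<le> (1 + r)\<^sup>2 * (norm x)\<^sup>2"
  by (rule norm_power2_le) (use assms norm_triangle_ineq[of x y] in \<open>simp add: algebra_simps\<close>)

text \<open>Compares the upper bound for the squared distance (weights \<open>s\<close>) with the
  guaranteed decrease (coefficients \<open>k\<close>). Any \<open>m\<close> below all quotients k/s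
  works, which is the origin of the minima in the rates.\<close>

lemma weighted_sum_bound:
  fixes m D :: real
  assumes "0 \<le> m" "0 \<le> X" "0 \<le> Y" "0 \<le> Z" "D \<le> N * (s\<^sub>1 * X + s\<^sub>2 * Y + s\<^sub>3 * Z)" "0 < N"
    and "m * s\<^sub>1 \<le> k\<^sub>1" "m * s\<^sub>2 \<le> k\<^sub>2" "m * s\<^sub>3 \<le> k\<^sub>3"
  shows "m / N * D \<le> k\<^sub>1 * X + k\<^sub>2 * Y + k\<^sub>3 * Z"
proof -
  have "m / N * D \<le> m / N * (N * (s\<^sub>1 * X + s\<^sub>2 * Y + s\<^sub>3 * Z))"
    by (intro mult_left_mono) (use assms in auto)
  also have "\<dots> = m * s\<^sub>1 * X + m * s\<^sub>2 * Y + m * s\<^sub>3 * Z"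
    using \<open>0 < N\<close> by (simp add: algebra_simps)
  also have "\<dots> \<le> k\<^sub>1 * X + k\<^sub>2 * Y + k\<^sub>3 * Z"
    by (intro add_mono mult_right_mono) (use assms in auto)
  finally show ?thesis .
qed

text \<open>If the estimate holds at every point, then \<open>c \<le> 1\<close> comes for free: evaluate it at some
  point other than \<open>zstar\<close>.\<close>

lemma contraction_from_squared_estimate:
  fixes zstar :: "'a::real_inner"
  assumes "\<exists>x::'a. x \<noteq> 0" and est: "\<And>z. (norm (P z - zstar))\<^sup>2 \<le> (1 - c) * (norm (z - zstar))\<^sup>2"
  shows "c \<le> 1" "norm (P z - zstar) \<le> sqrt (1 - c) * norm (z - zstar)"
proof -
  obtain x :: 'a where "x \<noteq> 0" using assms(1) by blast
  then have "0 \<le> (1 - c) * (norm x)\<^sup>2" "0 < (norm x)\<^sup>2"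
    using est[of "x + zstar"] order_trans[OF zero_le_power2] by fastforce+
  then show "c \<le> 1" by (simp add: zero_le_mult_iff)
  have "sqrt ((norm (P z - zstar))\<^sup>2) \<le> sqrt ((1 - c) * (norm (z - zstar))\<^sup>2)"
    by (rule real_sqrt_le_mono[OF est])
  then show "norm (P z - zstar) \<le> sqrt (1 - c) * norm (z - zstar)"
    by (simp add: real_sqrt_mult)
qed

section \<open>Contraction factors in the six cases\<close>

theorem theoremD6:
  fixes A B :: "'a::{real_inner, complete_space} \<Rightarrow> 'a set"
    and C :: "'a \<Rightarrow> 'a"
    and \<beta> \<epsilon> \<gamma> \<alpha> lam :: real
    and z zplus zstar :: 'a
  assumes nonzero_space: "\<exists>x::'a. x \<noteq> 0"
    and A: "maximal_monotone A"
    and B: "maximal_monotone B"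
    and \<beta>: "\<beta> > 0"
    and C: "cocoercive \<beta> C"
    and \<epsilon>: "0 < \<epsilon>" "\<epsilon> < 1"
    and \<gamma>: "0 < \<gamma>" "\<gamma> < 2 * \<beta> * \<epsilon>"
    and \<alpha>: "\<alpha> = 1 / (2 - \<epsilon>)"
    and lam: "0 < lam" "lam < 1 / \<alpha>"
    and zplus: "zplus = (1 - lam) *\<^sub>R z + lam *\<^sub>R splitting_map \<gamma> A B C z"
    and zstar: "splitting_map \<gamma> A B C zstar = zstar"
  shows
    "let holds_with = (\<lambda>c::real. 0 \<le> c \<and> c \<le> 1 \<and>
           norm (zplus - zstar) \<le> sqrt (1 - c) * norm (z - zstar))
     in
      (\<forall>L\<^sub>B \<mu>\<^sub>B. lipschitz_operator L\<^sub>B B \<and> strongly_monotone \<mu>\<^sub>B B \<longrightarrow>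
         holds_with (2 * \<mu>\<^sub>B * \<gamma> * lam / (1 + \<gamma> * L\<^sub>B)\<^sup>2)) \<and>
      (\<forall>L\<^sub>A \<mu>\<^sub>A. lipschitz_operator L\<^sub>A A \<and> strongly_monotone \<mu>\<^sub>A A \<longrightarrow>
         holds_with (lam / 3 * Min {2 * \<mu>\<^sub>A * \<gamma> / (1 + \<gamma> * L\<^sub>A)\<^sup>2,
                                 lam / 4 * (1 / (\<alpha> * lam) - 1),
                                 (2 * \<beta> - \<gamma> / \<epsilon>) / \<gamma>})) \<and>
      (\<forall>\<mu>\<^sub>A L\<^sub>B. strongly_monotone \<mu>\<^sub>A A \<and> lipschitz_operator L\<^sub>B B \<longrightarrow>
         holds_with (lam / (3 * (1 + 2 * \<gamma>\<^sup>2 * L\<^sub>B\<^sup>2)) *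
                     Min {2 * \<gamma> * \<mu>\<^sub>A, lam * (1 / (\<alpha> * lam) - 1)})) \<and>
      (\<forall>L\<^sub>A \<mu>\<^sub>B. lipschitz_operator L\<^sub>A A \<and> strongly_monotone \<mu>\<^sub>B B \<longrightarrow>
         holds_with (lam / 4 * Min {2 * \<gamma> * \<mu>\<^sub>B / (1 + 2 * \<gamma>\<^sup>2 * L\<^sub>A\<^sup>2),
                                 (2 * \<beta> - \<gamma> / \<epsilon>) / \<gamma>,
                                 lam / (1 + 2 * \<gamma>\<^sup>2 * L\<^sub>A\<^sup>2) * (1 / (\<alpha> * lam) - 1)})) \<and>
      (\<forall>L\<^sub>A \<mu>\<^sub>C \<eta>. lipschitz_operator L\<^sub>A A \<and> strongly_monotone \<mu>\<^sub>C (\<lambda>x. {C x}) \<and>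
           0 < \<eta> \<and> \<eta> < 1 \<and> 2 * \<eta> * \<beta> > \<gamma> / \<epsilon> \<longrightarrow>
         holds_with (lam / 4 * Min {2 * \<gamma> * \<mu>\<^sub>C * (1 - \<eta>) / (1 + 2 * \<gamma>\<^sup>2 * L\<^sub>A\<^sup>2),
                                 (2 * \<eta> * \<beta> - \<gamma> / \<epsilon>) / \<gamma>,
                                 lam / (1 + 2 * \<gamma>\<^sup>2 * L\<^sub>A\<^sup>2) * (1 / (\<alpha> * lam) - 1)})) \<and>
      (\<forall>L\<^sub>B \<mu>\<^sub>C \<eta>. lipschitz_operator L\<^sub>B B \<and> strongly_monotone \<mu>\<^sub>C (\<lambda>x. {C x}) \<and>
           0 < \<eta> \<and> \<eta> < 1 \<and> 2 * \<eta> * \<beta> > \<gamma> / \<epsilon> \<longrightarrow>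
         holds_with (2 * \<gamma> * lam * \<mu>\<^sub>C * (1 - \<eta>) / (1 + \<gamma> * L\<^sub>B)\<^sup>2))"
proof -
  \<comment> \<open>The step is a function of its starting point because the bound c \<le> 1 needs
    the estimate away from \<open>zstar\<close>.\<close>
  define P where "P z = (1 - lam) *\<^sub>R z + lam *\<^sub>R splitting_map \<gamma> A B C z" for z
  \<comment> \<open>This is 1/\<alpha> - \<lambda>, the coefficient of the squared residual in the
    one-step decrease.\<close>
  define R where "R = 2 - \<epsilon> - lam"
  have R: "0 < R" using lam \<alpha> by (simp add: R_def)
  have R_eq: "lam * (1 / (\<alpha> * lam) - 1) = R"
    unfolding R_def \<alpha> using lam(1) by (simp add: field_simps)
  \<comment> \<open>Reduces every case to one inequality about five vectors: the decrease per unit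
    of \<lambda> dominates \<open>k\<close> times the squared distance. The premises of
    \<open>bound\<close> list all that is known about the vectors, and each case selects from
    them.\<close>
  have holds: "0 \<le> lam * k \<and> lam * k \<le> 1 \<and>
      norm (zplus - zstar) \<le> sqrt (1 - lam * k) * norm (z - zstar)"
    if "0 \<le> k"
      and bound: "\<And>p q a b c :: 'a. \<lbrakk>p - q = a + b + c;
        0 \<le> inner q a; 0 \<le> inner p b; \<beta> / \<gamma> * (norm c)\<^sup>2 \<le> inner p c;
        \<And>\<mu>. strongly_monotone \<mu> A \<Longrightarrow> \<gamma> * \<mu> * (norm q)\<^sup>2 \<le> inner q a;
        \<And>\<mu>. strongly_monotone \<mu> B \<Longrightarrow> \<gamma> * \<mu> * (norm p)\<^sup>2 \<le> inner p b;
        \<And>\<mu>. strongly_monotone \<mu> (\<lambda>x. {C x}) \<Longrightarrow> \<gamma> * \<mu> * (norm p)\<^sup>2 \<le> inner p c;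
        \<And>L. lipschitz_operator L A \<Longrightarrow> 0 \<le> L \<and> norm a \<le> \<gamma> * L * norm q;
        \<And>L. lipschitz_operator L B \<Longrightarrow> 0 \<le> L \<and> norm b \<le> \<gamma> * L * norm p\<rbrakk>
        \<Longrightarrow> k * (norm (p + b))\<^sup>2 \<le> 2 * inner q a + 2 * inner p b + R * (norm (p - q))\<^sup>2
            + (2 * inner p c - (norm c)\<^sup>2 / \<epsilon>)" for k
  proof -
    have est: "(norm (P z - zstar))\<^sup>2 \<le> (1 - lam * k) * (norm (z - zstar))\<^sup>2" for z
    proof (rule splitting_map_differences[OF A B C \<gamma>(1) zstar, of z])
      fix p q a b c :: 'a
      assume d: "z - zstar = p + b"
        and T: "splitting_map \<gamma> A B C z - zstar = p + b - (p - q)"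
        and w: "p - q = a + b + c"
        and rest: "0 \<le> inner q a" "0 \<le> inner p b" "\<beta> / \<gamma> * (norm c)\<^sup>2 \<le> inner p c"
        "\<And>\<mu>. strongly_monotone \<mu> A \<Longrightarrow> \<gamma> * \<mu> * (norm q)\<^sup>2 \<le> inner q a"
        "\<And>\<mu>. strongly_monotone \<mu> B \<Longrightarrow> \<gamma> * \<mu> * (norm p)\<^sup>2 \<le> inner p b"
        "\<And>\<mu>. strongly_monotone \<mu> (\<lambda>x. {C x}) \<Longrightarrow> \<gamma> * \<mu> * (norm p)\<^sup>2 \<le> inner p c"
        "\<And>L. lipschitz_operator L A \<Longrightarrow> 0 \<le> L \<and> norm a \<le> \<gamma> * L * norm q"
        "\<And>L. lipschitz_operator L B \<Longrightarrow> 0 \<le> L \<and> norm b \<le> \<gamma> * L * norm p"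
      have "P z - zstar = (1 - lam) *\<^sub>R (z - zstar) + lam *\<^sub>R (splitting_map \<gamma> A B C z - zstar)"
        by (simp add: P_def algebra_simps)
      also have "\<dots> = p + b - lam *\<^sub>R (p - q)"
        unfolding T d by (simp add: algebra_simps)
      finally have "(norm (P z - zstar))\<^sup>2 \<le> (norm (p + b))\<^sup>2
          - lam * (2 * inner q a + 2 * inner p b + R * (norm (p - q))\<^sup>2
              + (2 * inner p c - (norm c)\<^sup>2 / \<epsilon>))"
        using relaxed_step_estimate[OF w \<epsilon>(1), of lam] lam(1) by (simp add: R_def)
      also have "\<dots> \<le> (norm (p + b))\<^sup>2 - lam * (k * (norm (p + b))\<^sup>2)"
      proof (intro diff_left_mono mult_left_mono)
        show "k * (norm (p + b))\<^sup>2 \<le> 2 * inner q a + 2 * inner p b + R * (norm (p - q))\<^sup>2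
            + (2 * inner p c - (norm c)\<^sup>2 / \<epsilon>)"
          by (rule bound) (fact w rest)+
      qed (use lam(1) in simp)
      finally show ?thesis unfolding d by (simp add: algebra_simps)
    qed
    show ?thesis
      using contraction_from_squared_estimate[of P zstar, OF nonzero_space est] lam(1) \<open>0 \<le> k\<close>
      by (simp add: zplus P_def)
  qed
  \<comment> \<open>Only a share \<eta> of \<open>inner p c\<close> pays for the Young term; the
    remaining share is left for strong monotonicity of C. Elsewhere \<eta> = 1.\<close>
  have coco: "(2 * \<eta> * \<beta> - \<gamma> / \<epsilon>) / \<gamma> * (norm c)\<^sup>2 \<le> 2 * \<eta> * inner p c - (norm c)\<^sup>2 / \<epsilon>"
    if "\<beta> / \<gamma> * (norm c)\<^sup>2 \<le> inner p c" "0 \<le> \<eta>" for \<eta> and p c :: 'a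
  proof -
    have "(2 * \<eta> * \<beta> - \<gamma> / \<epsilon>) / \<gamma> * (norm c)\<^sup>2
        = 2 * \<eta> * (\<beta> / \<gamma> * (norm c)\<^sup>2) - (norm c)\<^sup>2 / \<epsilon>"
      using \<gamma>(1) \<epsilon>(1) by (simp add: field_simps)
    also have "\<dots> \<le> 2 * \<eta> * inner p c - (norm c)\<^sup>2 / \<epsilon>"
      using that by (intro diff_right_mono mult_left_mono) auto
    finally show ?thesis .
  qed
  have \<beta>\<gamma>: "0 < 2 * \<beta> - \<gamma> / \<epsilon>" using \<gamma> \<epsilon> by (simp add: field_simps)
  have coco0: "0 \<le> 2 * inner p c - (norm c)\<^sup>2 / \<epsilon>"
    if "\<beta> / \<gamma> * (norm c)\<^sup>2 \<le> inner p c" for p c :: 'a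
  proof -
    have "0 \<le> (2 * 1 * \<beta> - \<gamma> / \<epsilon>) / \<gamma> * (norm c)\<^sup>2"
      using \<beta>\<gamma> \<gamma>(1) by simp
    also have "\<dots> \<le> 2 * 1 * inner p c - (norm c)\<^sup>2 / \<epsilon>"
      by (rule coco[OF that]) simp
    finally show ?thesis by simp
  qed
  have Lip: "0 \<le> L" if "lipschitz_operator L S" for L and S :: "'a \<Rightarrow> 'a set"
    using that lipschitz_on_nonneg unfolding lipschitz_operator_def by blast
  have pos: "0 < \<mu>" if "strongly_monotone \<mu> S" for \<mu> and S :: "'a \<Rightarrow> 'a set"
    using that unfolding strongly_monotone_def by blast

  \<comment> \<open>Serves cases 1 and 6. Since B is Lipschitz, \<open>p\<close> alone controls
    \<open>p + b\<close>, so a multiple of its squared norm suffices; \<open>mono\<close> leaves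
    open whether B or C provides it.\<close>
  have 1: "0 \<le> lam * (2 * \<gamma> * \<mu> / (1 + \<gamma> * L)\<^sup>2) \<and> lam * (2 * \<gamma> * \<mu> / (1 + \<gamma> * L)\<^sup>2) \<le> 1 \<and>
      norm (zplus - zstar) \<le> sqrt (1 - lam * (2 * \<gamma> * \<mu> / (1 + \<gamma> * L)\<^sup>2)) * norm (z - zstar)"
    if L: "lipschitz_operator L B" and "0 \<le> \<mu>"
      and mono: "\<And>p b c :: 'a. \<lbrakk>0 \<le> inner p b; \<beta> / \<gamma> * (norm c)\<^sup>2 \<le> inner p c;
        \<And>\<mu>. strongly_monotone \<mu> B \<Longrightarrow> \<gamma> * \<mu> * (norm p)\<^sup>2 \<le> inner p b;
        \<And>\<mu>. strongly_monotone \<mu> (\<lambda>x. {C x}) \<Longrightarrow> \<gamma> * \<mu> * (norm p)\<^sup>2 \<le> inner p c\<rbrakk>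
        \<Longrightarrow> 2 * \<gamma> * \<mu> * (norm p)\<^sup>2 \<le> 2 * inner p b + (2 * inner p c - (norm c)\<^sup>2 / \<epsilon>)"
    for L \<mu>
  proof (rule holds)
    have L0: "0 < (1 + \<gamma> * L)\<^sup>2"
      using Lip[OF L] \<gamma>(1) by (intro zero_less_power add_pos_nonneg) auto
    show "0 \<le> 2 * \<gamma> * \<mu> / (1 + \<gamma> * L)\<^sup>2" using \<open>0 \<le> \<mu>\<close> \<gamma>(1) by simp
    fix p q a b c :: 'a
    assume qa: "0 \<le> inner q a"
      and *: "0 \<le> inner p b" "\<beta> / \<gamma> * (norm c)\<^sup>2 \<le> inner p c"
        "\<And>\<mu>. strongly_monotone \<mu> B \<Longrightarrow> \<gamma> * \<mu> * (norm p)\<^sup>2 \<le> inner p b"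
        "\<And>\<mu>. strongly_monotone \<mu> (\<lambda>x. {C x}) \<Longrightarrow> \<gamma> * \<mu> * (norm p)\<^sup>2 \<le> inner p c"
      and lip: "\<And>L. lipschitz_operator L B \<Longrightarrow> 0 \<le> L \<and> norm b \<le> \<gamma> * L * norm p"
    have "2 * \<gamma> * \<mu> / (1 + \<gamma> * L)\<^sup>2 * (norm (p + b))\<^sup>2
        \<le> 2 * \<gamma> * \<mu> / (1 + \<gamma> * L)\<^sup>2 * ((1 + \<gamma> * L)\<^sup>2 * (norm p)\<^sup>2)"
      using lip[OF L] \<open>0 \<le> \<mu>\<close> \<gamma>(1)
      by (intro mult_left_mono norm_add_power2_le_lipschitz) auto
    also have "\<dots> = 2 * \<gamma> * \<mu> * (norm p)\<^sup>2" using L0 by simp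
    also have "\<dots> \<le> 2 * inner p b + (2 * inner p c - (norm c)\<^sup>2 / \<epsilon>)"
      by (rule mono) (fact *)+
    finally show "2 * \<gamma> * \<mu> / (1 + \<gamma> * L)\<^sup>2 * (norm (p + b))\<^sup>2
        \<le> 2 * inner q a + 2 * inner p b + R * (norm (p - q))\<^sup>2
          + (2 * inner p c - (norm c)\<^sup>2 / \<epsilon>)"
      using qa mult_nonneg_nonneg[OF less_imp_le[OF R] zero_le_power2[of "norm (p - q)"]]
      by linarith
  qed

  \<comment> \<open>Case 2: with w = p - q, the distance vector is (q - a) + 2w - c. Three summands
    give the factor 3, and the coefficient 2 of w gives the quarter in the bound on
    \<open>m\<close>.\<close>
  have 2: "0 \<le> lam * (m / 3) \<and> lam * (m / 3) \<le> 1 \<and>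
      norm (zplus - zstar) \<le> sqrt (1 - lam * (m / 3)) * norm (z - zstar)"
    if L: "lipschitz_operator L A" and \<mu>: "strongly_monotone \<mu> A" and "0 \<le> m"
      and m: "m \<le> 2 * \<mu> * \<gamma> / (1 + \<gamma> * L)\<^sup>2" "m \<le> R / 4" "m \<le> (2 * \<beta> - \<gamma> / \<epsilon>) / \<gamma>"
    for L \<mu> m
  proof (rule holds)
    show "0 \<le> m / 3" using \<open>0 \<le> m\<close> by simp
    have L0: "0 < (1 + \<gamma> * L)\<^sup>2"
      using Lip[OF L] \<gamma>(1) by (intro zero_less_power add_pos_nonneg) auto
    fix p q a b c :: 'a
    assume w: "p - q = a + b + c" and pb: "0 \<le> inner p b"
      and pc: "\<beta> / \<gamma> * (norm c)\<^sup>2 \<le> inner p c"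
      and sA: "\<And>\<mu>. strongly_monotone \<mu> A \<Longrightarrow> \<gamma> * \<mu> * (norm q)\<^sup>2 \<le> inner q a"
      and lip: "\<And>L. lipschitz_operator L A \<Longrightarrow> 0 \<le> L \<and> norm a \<le> \<gamma> * L * norm q"
    have "b = (p - q) - a - c" using w by simp
    then have d: "p + b = (q + - a) + 2 *\<^sub>R (p - q) + - c"
      by (simp add: algebra_simps scaleR_2)
    have qa: "(norm (q + - a))\<^sup>2 \<le> (1 + \<gamma> * L)\<^sup>2 * (norm q)\<^sup>2"
      using lip[OF L] by (intro norm_add_power2_le_lipschitz) simp
    have "(norm (p + b))\<^sup>2
        \<le> 3 * ((1 + \<gamma> * L)\<^sup>2 * (norm q)\<^sup>2 + 4 * (norm (p - q))\<^sup>2 + 1 * (norm c)\<^sup>2)"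
      using norm_add3_power2_le[of "q + - a" "2 *\<^sub>R (p - q)" "- c"] qa
      unfolding d by (simp add: power_mult_distrib)
    then have "m / 3 * (norm (p + b))\<^sup>2
        \<le> 2 * \<mu> * \<gamma> * (norm q)\<^sup>2 + R * (norm (p - q))\<^sup>2
          + (2 * \<beta> - \<gamma> / \<epsilon>) / \<gamma> * (norm c)\<^sup>2"
      by (rule weighted_sum_bound[rotated 4]) (use m L0 \<open>0 \<le> m\<close> in \<open>auto simp: pos_le_divide_eq\<close>)
    then show "m / 3 * (norm (p + b))\<^sup>2
        \<le> 2 * inner q a + 2 * inner p b + R * (norm (p - q))\<^sup>2
          + (2 * inner p c - (norm c)\<^sup>2 / \<epsilon>)"
      using sA[OF \<mu>] coco[OF pc, of 1] pb by (simp add: mult.commute mult.left_commute)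
  qed

  \<comment> \<open>Case 3: with w = p - q, the distance vector is q + w + b. The Lipschitz bound on
    \<open>b\<close> involves p = q + w, whose squared norm costs a factor 2; hence 1 + 2\<gamma>^2
    L^2.\<close>
  have 3: "0 \<le> lam * (m / (3 * (1 + 2 * \<gamma>\<^sup>2 * L\<^sup>2))) \<and> lam * (m / (3 * (1 + 2 * \<gamma>\<^sup>2 * L\<^sup>2))) \<le> 1 \<and>
      norm (zplus - zstar) \<le> sqrt (1 - lam * (m / (3 * (1 + 2 * \<gamma>\<^sup>2 * L\<^sup>2)))) * norm (z - zstar)"
    if L: "lipschitz_operator L B" and \<mu>: "strongly_monotone \<mu> A" and "0 \<le> m"
      and m: "m \<le> 2 * \<gamma> * \<mu>" "m \<le> R"
    for L \<mu> m
  proof (rule holds)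
    let ?N = "1 + 2 * \<gamma>\<^sup>2 * L\<^sup>2"
    have N: "0 < ?N" by (intro add_pos_nonneg) auto
    show "0 \<le> m / (3 * ?N)" using \<open>0 \<le> m\<close> N by simp
    fix p q a b c :: 'a
    assume w: "p - q = a + b + c" and pb: "0 \<le> inner p b"
      and pc: "\<beta> / \<gamma> * (norm c)\<^sup>2 \<le> inner p c"
      and sA: "\<And>\<mu>. strongly_monotone \<mu> A \<Longrightarrow> \<gamma> * \<mu> * (norm q)\<^sup>2 \<le> inner q a"
      and lip: "\<And>L. lipschitz_operator L B \<Longrightarrow> 0 \<le> L \<and> norm b \<le> \<gamma> * L * norm p"
    have "(norm b)\<^sup>2 \<le> (\<gamma> * L)\<^sup>2 * (norm p)\<^sup>2"
      using lip[OF L] by (intro norm_power2_le) simp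
    also have "\<dots> \<le> (\<gamma> * L)\<^sup>2 * (2 * ((norm q)\<^sup>2 + (norm (p - q))\<^sup>2))"
      using norm_add_power2_le[of q "p - q"] by (intro mult_left_mono) auto
    finally have "(norm (p + b))\<^sup>2
        \<le> 3 * ((norm q)\<^sup>2 + (norm (p - q))\<^sup>2 + (\<gamma> * L)\<^sup>2 * (2 * ((norm q)\<^sup>2 + (norm (p - q))\<^sup>2)))"
      using norm_add3_power2_le[of q "p - q" b] by simp
    also have "\<dots> = 3 * ?N * (1 * (norm q)\<^sup>2 + 1 * (norm (p - q))\<^sup>2 + 0 * (norm c)\<^sup>2)"
      by (simp add: algebra_simps power_mult_distrib)
    finally have "m / (3 * ?N) * (norm (p + b))\<^sup>2
        \<le> 2 * \<gamma> * \<mu> * (norm q)\<^sup>2 + R * (norm (p - q))\<^sup>2 + 0 * (norm c)\<^sup>2"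
      by (rule weighted_sum_bound[rotated 4]) (use m N \<open>0 \<le> m\<close> in auto)
    then show "m / (3 * ?N) * (norm (p + b))\<^sup>2
        \<le> 2 * inner q a + 2 * inner p b + R * (norm (p - q))\<^sup>2
          + (2 * inner p c - (norm c)\<^sup>2 / \<epsilon>)"
      using sA[OF \<mu>] coco0[OF pc] pb by simp
  qed

  \<comment> \<open>Serves cases 4 and 5: with w = p - q, the distance vector is p + w - a - c, four
    summands. Here \<open>a\<close> is bounded through q = p - w, and \<open>k\<close> is whatever
    multiple of the squared norm of \<open>c\<close> cocoercivity leaves over.\<close>
  have 4: "0 \<le> lam * (m / 4) \<and> lam * (m / 4) \<le> 1 \<and>
      norm (zplus - zstar) \<le> sqrt (1 - lam * (m / 4)) * norm (z - zstar)"
    if L: "lipschitz_operator L A" and "0 \<le> m"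
      and m: "m \<le> 2 * \<gamma> * \<mu> / (1 + 2 * \<gamma>\<^sup>2 * L\<^sup>2)" "m \<le> k" "m \<le> R / (1 + 2 * \<gamma>\<^sup>2 * L\<^sup>2)"
      and mono: "\<And>p b c :: 'a. \<lbrakk>0 \<le> inner p b; \<beta> / \<gamma> * (norm c)\<^sup>2 \<le> inner p c;
        \<And>\<mu>. strongly_monotone \<mu> B \<Longrightarrow> \<gamma> * \<mu> * (norm p)\<^sup>2 \<le> inner p b;
        \<And>\<mu>. strongly_monotone \<mu> (\<lambda>x. {C x}) \<Longrightarrow> \<gamma> * \<mu> * (norm p)\<^sup>2 \<le> inner p c\<rbrakk>
        \<Longrightarrow> 2 * \<gamma> * \<mu> * (norm p)\<^sup>2 + k * (norm c)\<^sup>2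
          \<le> 2 * inner p b + (2 * inner p c - (norm c)\<^sup>2 / \<epsilon>)"
    for L \<mu> m k
  proof (rule holds)
    let ?N = "1 + 2 * \<gamma>\<^sup>2 * L\<^sup>2"
    have N: "0 < ?N" by (intro add_pos_nonneg) auto
    show "0 \<le> m / 4" using \<open>0 \<le> m\<close> by simp
    fix p q a b c :: 'a
    assume w: "p - q = a + b + c" and qa: "0 \<le> inner q a"
      and *: "0 \<le> inner p b" "\<beta> / \<gamma> * (norm c)\<^sup>2 \<le> inner p c"
        "\<And>\<mu>. strongly_monotone \<mu> B \<Longrightarrow> \<gamma> * \<mu> * (norm p)\<^sup>2 \<le> inner p b"
        "\<And>\<mu>. strongly_monotone \<mu> (\<lambda>x. {C x}) \<Longrightarrow> \<gamma> * \<mu> * (norm p)\<^sup>2 \<le> inner p c"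
      and lip: "\<And>L. lipschitz_operator L A \<Longrightarrow> 0 \<le> L \<and> norm a \<le> \<gamma> * L * norm q"
    have "(norm (p + - (p - q)))\<^sup>2 \<le> 2 * ((norm p)\<^sup>2 + (norm (- (p - q)))\<^sup>2)"
      by (rule norm_add_power2_le)
    then have q: "(norm q)\<^sup>2 \<le> 2 * ((norm p)\<^sup>2 + (norm (p - q))\<^sup>2)"
      unfolding norm_minus_cancel by simp
    have "b = (p - q) - a - c" using w by simp
    then have d: "p + b = p + (p - q) + - a + - c" by simp
    have "(norm a)\<^sup>2 \<le> (\<gamma> * L)\<^sup>2 * (norm q)\<^sup>2"
      using lip[OF L] by (intro norm_power2_le) simp
    also have "\<dots> \<le> (\<gamma> * L)\<^sup>2 * (2 * ((norm p)\<^sup>2 + (norm (p - q))\<^sup>2))"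
      using q by (intro mult_left_mono) auto
    finally have a: "(norm a)\<^sup>2 \<le> (\<gamma> * L)\<^sup>2 * (2 * ((norm p)\<^sup>2 + (norm (p - q))\<^sup>2))" .
    have "(norm (p + b))\<^sup>2 \<le> 4 * ((norm p)\<^sup>2 + (norm (p - q))\<^sup>2 + (norm a)\<^sup>2 + (norm c)\<^sup>2)"
      using norm_add4_power2_le[of p "p - q" "- a" "- c"] unfolding d norm_minus_cancel .
    also have "\<dots> \<le> 4 * ((norm p)\<^sup>2 + (norm (p - q))\<^sup>2
            + (\<gamma> * L)\<^sup>2 * (2 * ((norm p)\<^sup>2 + (norm (p - q))\<^sup>2)) + (norm c)\<^sup>2)"
      by (intro mult_left_mono add_mono a) auto
    also have "\<dots> = 4 * (?N * (norm p)\<^sup>2 + ?N * (norm (p - q))\<^sup>2 + 1 * (norm c)\<^sup>2)"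
      by (simp add: algebra_simps power_mult_distrib)
    finally have "m / 4 * (norm (p + b))\<^sup>2
        \<le> 2 * \<gamma> * \<mu> * (norm p)\<^sup>2 + R * (norm (p - q))\<^sup>2 + k * (norm c)\<^sup>2"
      by (rule weighted_sum_bound[rotated 4])
        (use m(2) m(1,3)[unfolded pos_le_divide_eq[OF N]] \<open>0 \<le> m\<close> in auto)
    moreover have "2 * \<gamma> * \<mu> * (norm p)\<^sup>2 + k * (norm c)\<^sup>2
        \<le> 2 * inner p b + (2 * inner p c - (norm c)\<^sup>2 / \<epsilon>)"
      by (rule mono) (fact *)+
    ultimately show "m / 4 * (norm (p + b))\<^sup>2
        \<le> 2 * inner q a + 2 * inner p b + R * (norm (p - q))\<^sup>2
          + (2 * inner p c - (norm c)\<^sup>2 / \<epsilon>)"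
      using qa by linarith
  qed

  have mono_C: "2 * \<gamma> * (\<mu> * (1 - \<eta>)) * (norm p)\<^sup>2 + (2 * \<eta> * \<beta> - \<gamma> / \<epsilon>) / \<gamma> * (norm c)\<^sup>2
      \<le> 2 * inner p b + (2 * inner p c - (norm c)\<^sup>2 / \<epsilon>)"
    if "0 \<le> inner p b" "\<beta> / \<gamma> * (norm c)\<^sup>2 \<le> inner p c" "\<gamma> * \<mu> * (norm p)\<^sup>2 \<le> inner p c"
      "0 < \<eta>" "\<eta> < 1" for p b c :: 'a and \<mu> \<eta>
  proof -
    have "2 * (1 - \<eta>) * (\<gamma> * \<mu> * (norm p)\<^sup>2) \<le> 2 * (1 - \<eta>) * inner p c"
      using that by (intro mult_left_mono) auto
    moreover have "2 * (1 - \<eta>) * (\<gamma> * \<mu> * (norm p)\<^sup>2) = 2 * \<gamma> * (\<mu> * (1 - \<eta>)) * (norm p)\<^sup>2"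
      by simp
    moreover have "2 * (1 - \<eta>) * inner p c + 2 * \<eta> * inner p c = 2 * inner p c"
      by (simp add: algebra_simps)
    ultimately show ?thesis using coco[OF that(2), of \<eta>] that(1,4) by linarith
  qed
  have N: "0 < 1 + 2 * \<gamma>\<^sup>2 * L\<^sup>2" for L by (intro add_pos_nonneg) auto
  have R4: "lam / 4 * (1 / (\<alpha> * lam) - 1) = R / 4"
    and RN: "lam / M * (1 / (\<alpha> * lam) - 1) = R / M" for M
    using R_eq by (simp_all add: field_simps)

  \<comment> \<open>The constants are brought to the form \<lambda> times \<open>k\<close> required
    by \<open>holds\<close>, with \<mu>(1 - \<eta>) as the effective modulus when C is strongly
    monotone.\<close>
  have c1: "2 * \<mu> * \<gamma> * lam / (1 + \<gamma> * L)\<^sup>2 = lam * (2 * \<gamma> * \<mu> / (1 + \<gamma> * L)\<^sup>2)"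
    and c6: "2 * \<gamma> * lam * \<mu> * (1 - \<eta>) / (1 + \<gamma> * L)\<^sup>2
      = lam * (2 * \<gamma> * (\<mu> * (1 - \<eta>)) / (1 + \<gamma> * L)\<^sup>2)" for \<mu> L \<eta>
    by simp_all
  have cm: "lam / M * m = lam * (m / M)" for M m by simp
  have c5: "2 * \<gamma> * \<mu> * (1 - \<eta>) / M = 2 * \<gamma> * (\<mu> * (1 - \<eta>)) / M" for \<mu> \<eta> M
    by simp
  show ?thesis
    unfolding Let_def R_eq R4 RN unfolding c1 c6 c5 cm
  \<comment> \<open>The instantiation separates only conjuncts that start with a quantifier, so the
    three-part claim of each case stays whole.\<close>
  proof (intro conjI[of "All _"] allI impI; (elim conjE)?)
    fix L \<mu>
    assume "lipschitz_operator L B" and \<mu>: "strongly_monotone \<mu> B"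
    then show "0 \<le> lam * (2 * \<gamma> * \<mu> / (1 + \<gamma> * L)\<^sup>2) \<and> lam * (2 * \<gamma> * \<mu> / (1 + \<gamma> * L)\<^sup>2) \<le> 1 \<and>
      norm (zplus - zstar) \<le> sqrt (1 - lam * (2 * \<gamma> * \<mu> / (1 + \<gamma> * L)\<^sup>2)) * norm (z - zstar)"
    proof (intro 1)
      fix p b c :: 'a
      assume "\<beta> / \<gamma> * (norm c)\<^sup>2 \<le> inner p c"
        "\<And>\<mu>. strongly_monotone \<mu> B \<Longrightarrow> \<gamma> * \<mu> * (norm p)\<^sup>2 \<le> inner p b"
      from coco0[OF this(1)] this(2)[OF \<mu>]
      show "2 * \<gamma> * \<mu> * (norm p)\<^sup>2 \<le> 2 * inner p b + (2 * inner p c - (norm c)\<^sup>2 / \<epsilon>)" by simp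
    qed (use pos[OF \<mu>] in simp_all)
  next
    fix L \<mu>
    let ?m = "Min {2 * \<mu> * \<gamma> / (1 + \<gamma> * L)\<^sup>2, R / 4, (2 * \<beta> - \<gamma> / \<epsilon>) / \<gamma>}"
    assume L: "lipschitz_operator L A" and \<mu>: "strongly_monotone \<mu> A"
    show "0 \<le> lam * (?m / 3) \<and> lam * (?m / 3) \<le> 1 \<and>
      norm (zplus - zstar) \<le> sqrt (1 - lam * (?m / 3)) * norm (z - zstar)"
    proof (rule 2[OF L \<mu>])
      show "?m \<le> R / 4" by (rule Min_le) auto
    qed (use pos[OF \<mu>] R \<beta>\<gamma> \<gamma>(1) in auto)
  next
    fix \<mu> L
    let ?m = "Min {2 * \<gamma> * \<mu>, R}"
    assume \<mu>: "strongly_monotone \<mu> A" and L: "lipschitz_operator L B"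
    show "0 \<le> lam * (?m / (3 * (1 + 2 * \<gamma>\<^sup>2 * L\<^sup>2))) \<and> lam * (?m / (3 * (1 + 2 * \<gamma>\<^sup>2 * L\<^sup>2))) \<le> 1 \<and>
      norm (zplus - zstar) \<le> sqrt (1 - lam * (?m / (3 * (1 + 2 * \<gamma>\<^sup>2 * L\<^sup>2)))) * norm (z - zstar)"
      by (rule 3[OF L \<mu>]) (use pos[OF \<mu>] R \<gamma>(1) in auto)
  next
    fix L \<mu>
    let ?m = "Min {2 * \<gamma> * \<mu> / (1 + 2 * \<gamma>\<^sup>2 * L\<^sup>2), (2 * \<beta> - \<gamma> / \<epsilon>) / \<gamma>,
      R / (1 + 2 * \<gamma>\<^sup>2 * L\<^sup>2)}"
    assume L: "lipschitz_operator L A" and \<mu>: "strongly_monotone \<mu> B"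
    show "0 \<le> lam * (?m / 4) \<and> lam * (?m / 4) \<le> 1 \<and>
      norm (zplus - zstar) \<le> sqrt (1 - lam * (?m / 4)) * norm (z - zstar)"
    proof (rule 4[OF L, where \<mu> = \<mu> and k = "(2 * \<beta> - \<gamma> / \<epsilon>) / \<gamma>"])
      fix p b c :: 'a
      assume "\<beta> / \<gamma> * (norm c)\<^sup>2 \<le> inner p c"
        "\<And>\<mu>. strongly_monotone \<mu> B \<Longrightarrow> \<gamma> * \<mu> * (norm p)\<^sup>2 \<le> inner p b"
      from coco[OF this(1), of 1] this(2)[OF \<mu>]
      show "2 * \<gamma> * \<mu> * (norm p)\<^sup>2 + (2 * \<beta> - \<gamma> / \<epsilon>) / \<gamma> * (norm c)\<^sup>2
        \<le> 2 * inner p b + (2 * inner p c - (norm c)\<^sup>2 / \<epsilon>)" by simp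
    qed (use pos[OF \<mu>] R \<beta>\<gamma> \<gamma>(1) N[of L] in auto)
  next
    fix L \<mu> \<eta>
    let ?m = "Min {2 * \<gamma> * (\<mu> * (1 - \<eta>)) / (1 + 2 * \<gamma>\<^sup>2 * L\<^sup>2), (2 * \<eta> * \<beta> - \<gamma> / \<epsilon>) / \<gamma>,
      R / (1 + 2 * \<gamma>\<^sup>2 * L\<^sup>2)}"
    assume L: "lipschitz_operator L A" and \<mu>: "strongly_monotone \<mu> (\<lambda>x. {C x})"
      and \<eta>: "0 < \<eta>" "\<eta> < 1" "\<gamma> / \<epsilon> < 2 * \<eta> * \<beta>"
    show "0 \<le> lam * (?m / 4) \<and> lam * (?m / 4) \<le> 1 \<and>
      norm (zplus - zstar) \<le> sqrt (1 - lam * (?m / 4)) * norm (z - zstar)"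
    proof (rule 4[OF L, where \<mu> = "\<mu> * (1 - \<eta>)" and k = "(2 * \<eta> * \<beta> - \<gamma> / \<epsilon>) / \<gamma>"])
      fix p b c :: 'a
      assume *: "0 \<le> inner p b" "\<beta> / \<gamma> * (norm c)\<^sup>2 \<le> inner p c"
        "\<And>\<mu>. strongly_monotone \<mu> (\<lambda>x. {C x}) \<Longrightarrow> \<gamma> * \<mu> * (norm p)\<^sup>2 \<le> inner p c"
      show "2 * \<gamma> * (\<mu> * (1 - \<eta>)) * (norm p)\<^sup>2 + (2 * \<eta> * \<beta> - \<gamma> / \<epsilon>) / \<gamma> * (norm c)\<^sup>2
          \<le> 2 * inner p b + (2 * inner p c - (norm c)\<^sup>2 / \<epsilon>)"
        by (rule mono_C[OF *(1,2) *(3)[OF \<mu>] \<eta>(1,2)])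
    qed (use pos[OF \<mu>] R \<eta> \<gamma>(1) N[of L] in auto)
  next
    fix L \<mu> \<eta>
    let ?c = "lam * (2 * \<gamma> * (\<mu> * (1 - \<eta>)) / (1 + \<gamma> * L)\<^sup>2)"
    assume L: "lipschitz_operator L B" and \<mu>: "strongly_monotone \<mu> (\<lambda>x. {C x})"
      and \<eta>: "0 < \<eta>" "\<eta> < 1" "\<gamma> / \<epsilon> < 2 * \<eta> * \<beta>"
    show "0 \<le> ?c \<and> ?c \<le> 1 \<and> norm (zplus - zstar) \<le> sqrt (1 - ?c) * norm (z - zstar)"
    proof (rule 1[OF L])
      fix p b c :: 'a
      assume *: "0 \<le> inner p b" "\<beta> / \<gamma> * (norm c)\<^sup>2 \<le> inner p c"
        "\<And>\<mu>. strongly_monotone \<mu> (\<lambda>x. {C x}) \<Longrightarrow> \<gamma> * \<mu> * (norm p)\<^sup>2 \<le> inner p c"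
      have "0 \<le> (2 * \<eta> * \<beta> - \<gamma> / \<epsilon>) / \<gamma> * (norm c)\<^sup>2" using \<eta>(3) \<gamma>(1) by simp
      then show "2 * \<gamma> * (\<mu> * (1 - \<eta>)) * (norm p)\<^sup>2
          \<le> 2 * inner p b + (2 * inner p c - (norm c)\<^sup>2 / \<epsilon>)"
        using mono_C[OF *(1,2) *(3)[OF \<mu>] \<eta>(1,2)] by linarith
    qed (use pos[OF \<mu>] \<eta> in simp)
  qed
qed

end
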